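(* Let $K\ge 2$ and $T\ge 1$ be integers and $\alpha>0$. Let $l(1),\ldots,l(T)\ge 0$ be an achievable sequence of data rates for $K$-level memory cells, with payload $p=\frac1T\sum_{t=1}^T l(t)>0$ and coding efficiency $c=\frac{\alpha}{K}\sum_{t=1}^T l(t)$. Let $\beta_1,\ldots,\beta_T\in[0,\infty)$ be such that the distributions $$\mathbb{P}(V(t)=j)=\frac{\exp(-\beta_t j)}{\sum_{s=0}^{K-1}\exp(-\beta_t s)},\quad j=0,\ldots,K-1,\ t=1,\ldots,T,$$ form a solution (minimizer) of the optimization problem $$\min_{\mathbb{P}(V(1)),\ldots,\mathbb{P}(V(T))}\ \sum_{t=1}^T\mathbb{E}[V(t)]\quad\text{subject to}\quad \sum_{t=1}^T H(V(t))\ge Tp,$$ where the minimum is over all $T$-tuples of probability distributions on $\{0,1,\ldots,K-1\}$. Then $$c\le\frac{\alpha\sum_{t=1}^T\mathrm{rate}(\beta_t)}{\sum_{t=1}^T\mathrm{cost}(\beta_t)}.$$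
   Context: All logarithms and entropies here are natural, and rates are measured in nats. For $\beta\ge 0$, $$\mathrm{cost}(\beta)=\frac{\sum_{j=0}^{K-1}j\exp(-\beta j)}{\sum_{s=0}^{K-1}\exp(-\beta s)},\qquad \mathrm{rate}(\beta)=\beta\,\mathrm{cost}(\beta)+\log\Big(\sum_{s=0}^{K-1}\exp(-\beta s)\Big),$$ which are the mean and the entropy of the distribution on $\{0,\ldots,K-1\}$ with mass at $j$ proportional to $\exp(-\beta j)$. A memory block has $N$ cells; each cell is in a state in $\{0,1,\ldots,K-1\}$. After an erase all cells are in state $K-1$. Programming may decrease the state of each cell but never increase it. The block is used for $T$ rounds of recording between two erases. The constant $\alpha$ is a cost constant depending on the type of memory. A coding scheme with $N$ cells and $T$ rounds consists of finite message sets $\mathcal{M}_1,\ldots,\mathcal{M}_T$, encoders $\phi_t:\mathcal{M}_t\times\{0,\ldots,K-1\}^N\to\{0,\ldots,K-1\}^N$ such that $\phi_t(m,x)\le x$ coordinatewise for all $m,x$, and decoders $\psi_t:\{0,\ldots,K-1\}^N\to\mathcal{M}_t$. The messages $M(1),\ldots,M(T)$ are independent, with $M(t)$ uniform on $\mathcal{M}_t$. The block state evolves by $X_1^N(0)=(K-1,\ldots,K-1)$ and $X_1^N(t)=\phi_t(M(t),X_1^N(t-1))$. The rate of round $t$ is $\log(|\mathcal{M}_t|)/N$. The error probability is $\mathbb{P}(\exists t:\ \psi_t(X_1^N(t))\ne M(t))$. A sequence $l(1),\ldots,l(T)$ is achievable if for every $\varepsilon>0$ and $\delta>0$, for all sufficiently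 large $N$ there is a coding scheme with $N$ cells and $T$ rounds whose rate in round $t$ is at least $l(t)-\varepsilon$ for every $t=1,\ldots,T$ and whose error probability is at most $\delta$. *)

theory Defs
  imports "HOL-Probability.Probability"
begin

definition cost :: "nat \<Rightarrow> real \<Rightarrow> real" where
  "cost K \<beta> = (\<Sum>j<K. real j * exp (- \<beta> * real j)) / (\<Sum>s<K. exp (- \<beta> * real s))"

definition rate :: "nat \<Rightarrow> real \<Rightarrow> real" where
  "rate K \<beta> = \<beta> * cost K \<beta> + ln (\<Sum>s<K. exp (- \<beta> * real s))"

text \<open>A block of \<^term>\<open>N\<close> cells with \<^term>\<open>K\<close> levels is a function on the
  cell indices below \<^term>\<open>N\<close>.\<close>

definition blocks :: "nat \<Rightarrow> nat \<Rightarrow> (nat \<Rightarrow> nat) set" where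
  "blocks K N = {..<N} \<rightarrow>\<^sub>E {..<K}"

text \<open>Every finite message set is in bijection with a set of naturals, so messages are taken
  to be of type \<^typ>\<open>nat\<close>. Nonemptiness is what makes a uniform message possible.\<close>

definition coding_scheme ::
  "nat \<Rightarrow> nat \<Rightarrow> nat \<Rightarrow> (nat \<Rightarrow> nat set) \<Rightarrow> (nat \<Rightarrow> nat \<Rightarrow> (nat \<Rightarrow> nat) \<Rightarrow> (nat \<Rightarrow> nat))
    \<Rightarrow> (nat \<Rightarrow> (nat \<Rightarrow> nat) \<Rightarrow> nat) \<Rightarrow> bool" where
  "coding_scheme K N T Msg \<phi> \<psi> \<longleftrightarrow>
     (\<forall>t\<in>{1..T}.
        finite (Msg t) \<and> Msg t \<noteq> {} \<and>
        (\<forall>m\<in>Msg t. \<forall>x\<in>blocks K N. \<phi> t m x \<in> blocks K N \<and> (\<forall>i<N. \<phi> t m x i \<le> x i)) \<and>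
        (\<forall>x\<in>blocks K N. \<psi> t x \<in> Msg t))"

primrec block_state ::
  "nat \<Rightarrow> nat \<Rightarrow> (nat \<Rightarrow> nat \<Rightarrow> (nat \<Rightarrow> nat) \<Rightarrow> (nat \<Rightarrow> nat)) \<Rightarrow> (nat \<Rightarrow> nat) \<Rightarrow> nat \<Rightarrow> (nat \<Rightarrow> nat)"
where
  "block_state K N \<phi> m 0 = (\<lambda>i\<in>{..<N}. K - 1)"
| "block_state K N \<phi> m (Suc t) = \<phi> (Suc t) (m (Suc t)) (block_state K N \<phi> m t)"

definition messages_pmf :: "nat \<Rightarrow> (nat \<Rightarrow> nat set) \<Rightarrow> (nat \<Rightarrow> nat) pmf" where
  "messages_pmf T Msg = Pi_pmf {1..T} 0 (\<lambda>t. pmf_of_set (Msg t))"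

definition error_probability ::
  "nat \<Rightarrow> nat \<Rightarrow> nat \<Rightarrow> (nat \<Rightarrow> nat set) \<Rightarrow> (nat \<Rightarrow> nat \<Rightarrow> (nat \<Rightarrow> nat) \<Rightarrow> (nat \<Rightarrow> nat))
    \<Rightarrow> (nat \<Rightarrow> (nat \<Rightarrow> nat) \<Rightarrow> nat) \<Rightarrow> real" where
  "error_probability K N T Msg \<phi> \<psi> =
     measure_pmf.prob (messages_pmf T Msg)
       {m. \<exists>t\<in>{1..T}. \<psi> t (block_state K N \<phi> m t) \<noteq> m t}"

definition achievable :: "nat \<Rightarrow> nat \<Rightarrow> (nat \<Rightarrow> real) \<Rightarrow> bool" where
  "achievable K T l \<longleftrightarrow>
     (\<forall>\<epsilon>>0. \<forall>\<delta>>0. \<forall>\<^sub>F N in sequentially. \<exists>Msg \<phi> \<psi>.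
        coding_scheme K N T Msg \<phi> \<psi> \<and>
        (\<forall>t\<in>{1..T}. ln (real (card (Msg t))) / real N \<ge> l t - \<epsilon>) \<and>
        error_probability K N T Msg \<phi> \<psi> \<le> \<delta>)"

definition pmf_entropy :: "nat pmf \<Rightarrow> real" where
  "pmf_entropy p = prob_space.entropy (measure_pmf p) (exp 1) (count_space UNIV) (\<lambda>x. x)"

lemma pmf_entropy_eq:
  assumes "set_pmf p \<subseteq> {..<K}"
  shows "pmf_entropy p = - (\<Sum>j<K. pmf p j * ln (pmf p j))"
proof -
  interpret C: sigma_finite_measure "count_space (UNIV :: nat set)"
    by (rule sigma_finite_measure_count_space)
  have "pmf_entropy p = - KL_divergence (exp 1) (count_space UNIV) (measure_pmf p)"
    unfolding pmf_entropy_def prob_space.entropy_def[OF prob_space_measure_pmf]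
    by (simp add: distr_id2)
  also have "KL_divergence (exp 1) (count_space UNIV) (measure_pmf p)
      = (\<integral>x. pmf p x * log (exp 1) (pmf p x) \<partial>count_space UNIV)"
    unfolding measure_pmf_eq_density by (rule C.KL_density) auto
  also have "\<dots> = (\<integral>x. indicator {..<K} x *\<^sub>R (pmf p x * ln (pmf p x)) \<partial>count_space UNIV)"
    using assms
    by (intro Bochner_Integration.integral_cong)
       (auto simp: indicator_def log_def set_pmf_eq subset_iff)
  also have "\<dots> = (\<integral>x. pmf p x * ln (pmf p x) \<partial>count_space {..<K})"
    by (subst integral_restrict_space[symmetric]) (auto simp: restrict_count_space)
  also have "\<dots> = (\<Sum>j<K. pmf p j * ln (pmf p j))"
    by (rule lebesgue_integral_count_space_finite) simp
  finally show ?thesis .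
qed

text \<open>Only the components at rounds \<open>1, \<dots>, T\<close> of a tuple \<^term>\<open>V\<close> are meaningful.\<close>

definition feasible :: "nat \<Rightarrow> nat \<Rightarrow> real \<Rightarrow> (nat \<Rightarrow> nat pmf) \<Rightarrow> bool" where
  "feasible K T p V \<longleftrightarrow>
     (\<forall>t\<in>{1..T}. set_pmf (V t) \<subseteq> {..<K}) \<and>
     (\<Sum>t=1..T. pmf_entropy (V t)) \<ge> real T * p"

definition total_mean :: "nat \<Rightarrow> (nat \<Rightarrow> nat pmf) \<Rightarrow> real" where
  "total_mean T V = (\<Sum>t=1..T. measure_pmf.expectation (V t) real)"

end

theory Submission
  imports Defs
begin

text \<open>Call the vector of decreases of a single cell over the \<open>T\<close> rounds its drop vector. There are
  finitely many, say \<open>C\<close>, drop vectors: those in \<open>{0..K-1}\<^sup>T\<close> with sum at most \<open>K - 1\<close>. Message tuples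
  that are decoded correctly are determined by the drop vectors of the \<open>N\<close> cells, so an achievable
  sequence has total rate at most \<open>ln C\<close>. The marginals of the uniform distribution on the drop
  vectors have, by subadditivity, total entropy at least \<open>ln C\<close>, and their total mean is at most
  \<open>K - 1\<close>. They are therefore feasible, so the minimizer has total mean at most \<open>K\<close>, while its total
  entropy is at least the total rate.\<close>

section \<open>Subadditivity of entropy for uniform distributions\<close>

text \<open>In the form of an expectation, the entropy of a marginal can be pulled back along
  \<open>map_pmf\<close> to an average over the underlying set.\<close>

lemma pmf_entropy_eq_expectation:
  assumes "set_pmf p \<subseteq> {..<K}"
  shows "pmf_entropy p = - measure_pmf.expectation p (\<lambda>j. ln (pmf p j))"
proof -
  have "measure_pmf.expectation p (\<lambda>j. ln (pmf p j)) = (\<Sum>j<K. pmf p j *\<^sub>R ln (pmf p j))"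
    by (rule integral_measure_pmf) (use assms in auto)
  then show ?thesis
    by (simp add: pmf_entropy_eq[OF assms])
qed

text \<open>The left side is the entropy of the uniform distribution on \<open>S\<close>, so this is
  subadditivity. It follows from Gibbs' inequality, comparing that distribution with the product of
  its own marginals.\<close>

lemma ln_card_le_sum_entropy_marginals:
  assumes "finite A" and "S \<noteq> {}" and S: "S \<subseteq> A \<rightarrow>\<^sub>E {..<K}"
  shows "ln (real (card S)) \<le> (\<Sum>t\<in>A. pmf_entropy (map_pmf (\<lambda>v. v t) (pmf_of_set S)))"
proof -
  have "finite S"
    using finite_subset[OF S] \<open>finite A\<close> by (auto intro: finite_PiE)
  note fin = \<open>finite S\<close> and ne = \<open>S \<noteq> {}\<close>
  define W where "W t = map_pmf (\<lambda>v. v t) (pmf_of_set S)" for t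
  define C where "C = real (card S)"
  \<comment> \<open>The product of the marginals: it has total mass 1 on the whole box, hence mass
    at most 1 on \<open>S\<close>.\<close>
  define q where "q v = (\<Prod>t\<in>A. pmf (W t) (v t))" for v
  have C: "C > 0"
    using fin ne by (simp add: C_def card_gt_0_iff)
  have W_set: "set_pmf (W t) \<subseteq> {..<K}" if "t \<in> A" for t
    using that S fin ne by (auto simp: W_def PiE_iff subset_iff)
  have W_pos: "pmf (W t) (v t) > 0" if "v \<in> S" for v t
    using that fin ne by (auto simp: W_def pmf_positive_iff)
  have ent: "C * pmf_entropy (W t) = - (\<Sum>v\<in>S. ln (pmf (W t) (v t)))" if "t \<in> A" for t
  proof -
    have "measure_pmf.expectation (W t) (\<lambda>j. ln (pmf (W t) j)) = (\<Sum>v\<in>S. ln (pmf (W t) (v t))) / C"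
      unfolding C_def integral_pmf_of_set[OF ne fin, symmetric]
      by (subst W_def, subst integral_map_pmf) simp
    then show ?thesis
      using C pmf_entropy_eq_expectation[OF W_set[OF that]] by simp
  qed
  have "(\<Sum>v\<in>S. q v) \<le> (\<Sum>v\<in>A \<rightarrow>\<^sub>E {..<K}. q v)"
    using S \<open>finite A\<close> by (intro sum_mono2 finite_PiE) (auto simp: q_def intro!: prod_nonneg)
  also have "\<dots> = (\<Prod>t\<in>A. \<Sum>j<K. pmf (W t) j)"
    unfolding q_def using \<open>finite A\<close> by (subst prod_sum_PiE) auto
  also have "\<dots> = 1"
    using W_set by (intro prod.neutral ballI sum_pmf_eq_1) auto
  finally have q_le: "(\<Sum>v\<in>S. q v) \<le> 1" .
  \<comment> \<open>By \<open>ent\<close>, the left side is \<open>C\<close> times the difference of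
    \<open>ln C\<close> and the total marginal entropy; the chain shows that it is at most
    0.\<close>
  have "C * ln C + (\<Sum>t\<in>A. \<Sum>v\<in>S. ln (pmf (W t) (v t)))
      = (\<Sum>v\<in>S. ln C + (\<Sum>t\<in>A. ln (pmf (W t) (v t))))"
    by (subst sum.swap) (simp add: sum.distrib C_def)
  also have "\<dots> = (\<Sum>v\<in>S. ln (C * q v))"
  proof (rule sum.cong[OF refl])
    fix v assume v: "v \<in> S"
    have "q v > 0"
      using v W_pos by (auto simp: q_def intro: prod_pos)
    moreover have "ln (q v) = (\<Sum>t\<in>A. ln (pmf (W t) (v t)))"
      unfolding q_def using v W_pos \<open>finite A\<close> by (subst ln_prod) (auto simp: less_imp_neq[THEN not_sym])
    ultimately show "ln C + (\<Sum>t\<in>A. ln (pmf (W t) (v t))) = ln (C * q v)"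
      using C by (simp add: ln_mult)
  qed
  \<comment> \<open>\<open>ln x \<le> x - 1\<close> is applied to the ratio of \<open>q v\<close> to
    the uniform mass \<open>1 / C\<close>.\<close>
  also have "\<dots> \<le> (\<Sum>v\<in>S. C * q v - 1)"
    using C W_pos by (intro sum_mono ln_le_minus_one mult_pos_pos) (auto simp: q_def intro!: prod_pos)
  also have "\<dots> = C * (\<Sum>v\<in>S. q v) - C"
    by (simp add: sum_subtractf sum_distrib_left C_def)
  also have "\<dots> \<le> 0"
    using C q_le by simp
  finally have "C * ln C \<le> C * (\<Sum>t\<in>A. pmf_entropy (W t))"
    using ent by (simp add: sum_distrib_left sum_negf)
  then show ?thesis
    using C by (simp add: C_def W_def)
qed

section \<open>Drop vectors and the history of a block\<close>

definition drop_vectors :: "nat \<Rightarrow> nat \<Rightarrow> (nat \<Rightarrow> nat) set" where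
  "drop_vectors K T = {v \<in> {1..T} \<rightarrow>\<^sub>E {..<K}. (\<Sum>t=1..T. v t) < K}"

lemma finite_drop_vectors: "finite (drop_vectors K T)"
  unfolding drop_vectors_def by (intro finite_Collect_conjI disjI1) (simp add: finite_PiE)

lemma drop_vectors_nonempty:
  assumes "K > 0"
  shows "drop_vectors K T \<noteq> {}"
proof -
  have "(\<lambda>t\<in>{1..T}. 0) \<in> drop_vectors K T"
    using assms by (auto simp: drop_vectors_def)
  then show ?thesis by blast
qed

lemma block_state_in_blocks:
  assumes "coding_scheme K N T Msg \<phi> \<psi>" and "K > 0"
    and "\<And>t. t \<in> {1..T} \<Longrightarrow> m t \<in> Msg t" and "t \<le> T"
  shows "block_state K N \<phi> m t \<in> blocks K N"
  using \<open>t \<le> T\<close>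
proof (induction t)
  case 0
  then show ?case using assms(2) by (auto simp: blocks_def restrict_PiE_iff simp del: restrict_apply)
next
  case (Suc t)
  then show ?case using assms(1,3) by (simp add: coding_scheme_def)
qed

text \<open>The cell index comes first, then the round. Rounds start at 1, so \<open>t - 1\<close>
  is the preceding state; the truncated subtraction is exact whenever no encoder raises a
  level.\<close>

definition cell_drops ::
  "nat \<Rightarrow> nat \<Rightarrow> nat \<Rightarrow> (nat \<Rightarrow> nat \<Rightarrow> (nat \<Rightarrow> nat) \<Rightarrow> (nat \<Rightarrow> nat)) \<Rightarrow> (nat \<Rightarrow> nat) \<Rightarrow> nat \<Rightarrow> nat \<Rightarrow> nat"
where
  "cell_drops K N T \<phi> m = (\<lambda>i\<in>{..<N}. \<lambda>t\<in>{1..T}.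
     block_state K N \<phi> m (t - 1) i - block_state K N \<phi> m t i)"

text \<open>The drops telescope from the erased level \<open>K - 1\<close>, since the encoders of a
  coding scheme never raise a level.\<close>

lemma block_state_eq_cell_drops:
  assumes "coding_scheme K N T Msg \<phi> \<psi>" and "K > 0"
    and "\<And>t. t \<in> {1..T} \<Longrightarrow> m t \<in> Msg t" and "t \<le> T" and "i < N"
  shows "block_state K N \<phi> m t i + (\<Sum>s=1..t. cell_drops K N T \<phi> m i s) = K - 1"
  using \<open>t \<le> T\<close>
proof (induction t)
  case 0
  then show ?case using \<open>i < N\<close> by simp
next
  case (Suc t)
  have "block_state K N \<phi> m t \<in> blocks K N"
    using Suc.prems by (intro block_state_in_blocks[OF assms(1-3)]) auto
  then have "block_state K N \<phi> m (Suc t) i \<le> block_state K N \<phi> m t i"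
    using assms(1,3,5) Suc.prems by (simp add: coding_scheme_def)
  then have "block_state K N \<phi> m (Suc t) i + cell_drops K N T \<phi> m i (Suc t) = block_state K N \<phi> m t i"
    using Suc.prems \<open>i < N\<close> by (simp add: cell_drops_def del: block_state.simps)
  then show ?case
    using Suc by (simp del: block_state.simps)
qed

lemma cell_drops_in_drop_vectors:
  assumes "coding_scheme K N T Msg \<phi> \<psi>" and "K > 0"
    and "\<And>t. t \<in> {1..T} \<Longrightarrow> m t \<in> Msg t"
  shows "cell_drops K N T \<phi> m \<in> {..<N} \<rightarrow>\<^sub>E drop_vectors K T"
proof -
  have "cell_drops K N T \<phi> m i \<in> drop_vectors K T" if i: "i < N" for i
  proof -
    have sum: "(\<Sum>s=1..T. cell_drops K N T \<phi> m i s) < K"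
      using block_state_eq_cell_drops[OF assms, of T i] i \<open>K > 0\<close> by simp
    moreover have "cell_drops K N T \<phi> m i t < K" if "t \<in> {1..T}" for t
      using member_le_sum[of t "{1..T}" "cell_drops K N T \<phi> m i"] that sum by simp
    moreover have "cell_drops K N T \<phi> m i \<in> extensional {1..T}"
      using i by (simp add: cell_drops_def)
    ultimately show ?thesis
      by (simp add: drop_vectors_def PiE_iff)
  qed
  then show ?thesis
    by (auto simp: PiE_iff cell_drops_def)
qed

text \<open>Each level is \<open>K - 1\<close> minus a partial sum of drops, so the drops record the
  whole history.\<close>

lemma block_state_determined_by_cell_drops:
  assumes "coding_scheme K N T Msg \<phi> \<psi>" and "K > 0"
    and "\<And>t. t \<in> {1..T} \<Longrightarrow> m t \<in> Msg t" and "\<And>t. t \<in> {1..T} \<Longrightarrow> m' t \<in> Msg t"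
    and "cell_drops K N T \<phi> m = cell_drops K N T \<phi> m'" and "t \<le> T"
  shows "block_state K N \<phi> m t = block_state K N \<phi> m' t"
proof (rule PiE_ext)
  show "block_state K N \<phi> m t \<in> {..<N} \<rightarrow>\<^sub>E {..<K}" "block_state K N \<phi> m' t \<in> {..<N} \<rightarrow>\<^sub>E {..<K}"
    using block_state_in_blocks[OF assms(1-3,6)] block_state_in_blocks[OF assms(1,2,4,6)]
    by (simp_all add: blocks_def)
  show "block_state K N \<phi> m t i = block_state K N \<phi> m' t i" if "i \<in> {..<N}" for i
    using block_state_eq_cell_drops[OF assms(1-3,6), of i]
      block_state_eq_cell_drops[OF assms(1,2,4,6), of i] assms(5) that by simp
qed

section \<open>Counting correctly decoded message tuples\<close>

text \<open>Message tuples are uniform, so the left side counts the correctly decoded ones. The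
  drops of the cells determine such a tuple: they fix every state, and the decoders read the
  messages off the states.\<close>

lemma messages_le_card_drop_vectors:
  assumes cs: "coding_scheme K N T Msg \<phi> \<psi>" and K: "K > 0"
  shows "(1 - error_probability K N T Msg \<phi> \<psi>) * (\<Prod>t=1..T. real (card (Msg t)))
    \<le> real (card (drop_vectors K T)) ^ N"
proof -
  \<comment> \<open>The support of \<open>messages_pmf\<close>: the default 0 outside the rounds
    lets tuples be counted as whole functions.\<close>
  define P where "P = PiE_dflt {1..T} 0 Msg"
  define E where "E = {m. \<exists>t\<in>{1..T}. \<psi> t (block_state K N \<phi> m t) \<noteq> m t}"
  have Msg: "finite (Msg t)" "Msg t \<noteq> {}" if "t \<in> {1..T}" for t
    using cs that by (auto simp: coding_scheme_def)
  have P: "finite P" "P \<noteq> {}"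
    using Msg by (auto simp: P_def simp del: atLeastAtMost_iff)
  have P_card: "real (card P) = (\<Prod>t=1..T. real (card (Msg t)))"
    unfolding P_def using Msg by (subst card_PiE_dflt) auto
  have "error_probability K N T Msg \<phi> \<psi> = real (card (P \<inter> E)) / real (card P)"
    unfolding error_probability_def messages_pmf_def E_def[symmetric]
    by (subst Pi_pmf_of_set) (use Msg in \<open>auto simp only: P_def[symmetric] measure_pmf_of_set[OF P(2,1)] finite_atLeastAtMost\<close>)
  moreover have "card P = card (P \<inter> E) + card (P - E)"
    using P by (simp add: card_Int_Diff)
  moreover have "real (card P) > 0"
    using P by (simp add: card_gt_0_iff)
  ultimately have "(1 - error_probability K N T Msg \<phi> \<psi>) * real (card P) = real (card (P - E))"
    by (simp add: left_diff_distrib)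
  also have "card (P - E) \<le> card ({..<N} \<rightarrow>\<^sub>E drop_vectors K T)"
  proof (rule card_inj_on_le)
    have mem: "m t \<in> Msg t" if "m \<in> P" "t \<in> {1..T}" for m t
      using that by (auto simp: P_def PiE_dflt_def)
    show "cell_drops K N T \<phi> ` (P - E) \<subseteq> {..<N} \<rightarrow>\<^sub>E drop_vectors K T"
      using cell_drops_in_drop_vectors[OF cs K] mem by blast
    show "finite ({..<N} \<rightarrow>\<^sub>E drop_vectors K T)"
      by (simp add: finite_PiE finite_drop_vectors)
    show "inj_on (cell_drops K N T \<phi>) (P - E)"
    proof (rule inj_onI)
      fix m m' assume m: "m \<in> P - E" and m': "m' \<in> P - E"
        and eq: "cell_drops K N T \<phi> m = cell_drops K N T \<phi> m'"
      show "m = m'"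
      proof
        fix t
        show "m t = m' t"
        proof (cases "t \<in> {1..T}")
          case True
          then have "block_state K N \<phi> m t = block_state K N \<phi> m' t"
            using m m' mem by (intro block_state_determined_by_cell_drops[OF cs K _ _ eq]) auto
          \<comment> \<open>Both tuples avoid \<open>E\<close>, so decoding the common state returns
            both \<open>m t\<close> and \<open>m' t\<close>.\<close>
          then show ?thesis
            using True m m' by (force simp: E_def)
        next
          case False
          then show ?thesis
            using m m' by (auto simp: P_def PiE_dflt_def)
        qed
      qed
    qed
  qed
  also have "card ({..<N} \<rightarrow>\<^sub>E drop_vectors K T) = card (drop_vectors K T) ^ N"
    by (simp add: card_funcsetE)
  finally show ?thesis
    by (simp add: P_card)
qed

text \<open>With error at most 1/2, at least half of the tuples are counted. The lost factor 2 costs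
  only \<open>ln 2 / N\<close> per cell, which vanishes for large \<open>N\<close>.\<close>

lemma achievable_sum_le:
  assumes "achievable K T l" and K: "K > 0"
  shows "(\<Sum>t=1..T. l t) \<le> ln (real (card (drop_vectors K T)))"
proof (rule field_le_epsilon)
  fix e :: real assume "e > 0"
  \<comment> \<open>Of the \<open>T + 1\<close> shares of \<open>e\<close>, \<open>T\<close> cover
    the rate slack of the rounds and one covers the factor 2.\<close>
  define \<epsilon> where "\<epsilon> = e / (real T + 1)"
  have "real T + 1 > 0"
    by simp
  then have "\<epsilon> > 0" "(real T + 1) * \<epsilon> = e"
    using \<open>e > 0\<close> by (simp_all add: \<epsilon>_def del: of_nat_Suc)
  then have \<epsilon>: "\<epsilon> > 0" "real T * \<epsilon> + \<epsilon> = e"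
    by (simp_all add: distrib_right)
  let ?C = "real (card (drop_vectors K T))"
  have C: "?C > 0"
    using K by (simp add: card_gt_0_iff finite_drop_vectors drop_vectors_nonempty)
  have "\<forall>\<^sub>F N in sequentially. \<exists>Msg \<phi> \<psi>. coding_scheme K N T Msg \<phi> \<psi> \<and>
        (\<forall>t\<in>{1..T}. ln (real (card (Msg t))) / real N \<ge> l t - \<epsilon>) \<and>
        error_probability K N T Msg \<phi> \<psi> \<le> 1 / 2"
    using assms(1)[unfolded achievable_def, rule_format, OF \<epsilon>(1), of "1 / 2"] by simp
  \<comment> \<open>Such \<open>N\<close> satisfy \<open>ln 2 < N * \<epsilon>\<close>, and they are
    positive, so the rates are genuine quotients.\<close>
  moreover have "\<forall>\<^sub>F N in sequentially. real N > ln 2 / \<epsilon>"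
    using filterlim_real_sequentially by (auto simp: filterlim_at_top_dense)
  ultimately have "\<forall>\<^sub>F N in sequentially. real N > ln 2 / \<epsilon> \<and> (\<exists>Msg \<phi> \<psi>. coding_scheme K N T Msg \<phi> \<psi> \<and>
        (\<forall>t\<in>{1..T}. ln (real (card (Msg t))) / real N \<ge> l t - \<epsilon>) \<and>
        error_probability K N T Msg \<phi> \<psi> \<le> 1 / 2)"
    by eventually_elim blast
  then obtain N Msg \<phi> \<psi> where N: "real N > ln 2 / \<epsilon>"
    and cs: "coding_scheme K N T Msg \<phi> \<psi>"
    and rates: "\<And>t. t \<in> {1..T} \<Longrightarrow> l t - \<epsilon> \<le> ln (real (card (Msg t))) / real N"
    and err: "error_probability K N T Msg \<phi> \<psi> \<le> 1 / 2"
    using eventually_happens'[OF sequentially_bot] by blast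
  have "ln 2 / \<epsilon> > 0"
    using \<epsilon> by simp
  then have N_pos: "real N > 0"
    using N by linarith
  have Msg: "real (card (Msg t)) > 0" if "t \<in> {1..T}" for t
    using cs that by (auto simp: coding_scheme_def card_gt_0_iff)
  let ?M = "\<Prod>t=1..T. real (card (Msg t))"
  have M: "?M > 0"
    using Msg by (intro prod_pos) auto
  have "1 / 2 * ?M \<le> (1 - error_probability K N T Msg \<phi> \<psi>) * ?M"
    using err M by (intro mult_right_mono) auto
  also have "\<dots> \<le> ?C ^ N"
    by (rule messages_le_card_drop_vectors[OF cs K])
  finally have "?M \<le> 2 * ?C ^ N" by simp
  then have "ln ?M \<le> ln (2 * ?C ^ N)"
    using M by (simp add: ln_mono)
  also have "\<dots> = ln 2 + real N * ln ?C"
    using C by (simp add: ln_mult ln_realpow)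
  finally have lnM: "ln ?M \<le> ln 2 + real N * ln ?C" .
  have "real N * ((\<Sum>t=1..T. l t) - real T * \<epsilon>) = (\<Sum>t=1..T. real N * (l t - \<epsilon>))"
    by (simp add: sum_subtractf sum_distrib_left algebra_simps)
  also have "\<dots> \<le> (\<Sum>t=1..T. ln (real (card (Msg t))))"
    using rates N_pos by (intro sum_mono) (simp add: field_simps)
  also have "\<dots> = ln ?M"
    using Msg by (subst ln_prod) (auto simp: less_imp_neq[THEN not_sym])
  also have "\<dots> \<le> real N * \<epsilon> + real N * ln ?C"
    using lnM N \<epsilon> by (simp add: field_simps)
  finally have "real N * ((\<Sum>t=1..T. l t) - real T * \<epsilon>) \<le> real N * (\<epsilon> + ln ?C)"
    by (simp add: algebra_simps)
  then show "(\<Sum>t=1..T. l t) \<le> ln ?C + e"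
    using N_pos \<epsilon> by simp
qed

section \<open>A feasible competitor from the drop vectors\<close>

text \<open>Exchanging the sums turns the total mean into the average of the total drop, and every
  drop vector has sum below \<open>K\<close>. The entropy bound is subadditivity.\<close>

lemma drop_vector_marginals:
  fixes K T :: nat
  assumes K: "K > 0"
  defines "W \<equiv> \<lambda>t. map_pmf (\<lambda>v. v t) (pmf_of_set (drop_vectors K T))"
  shows "t \<in> {1..T} \<Longrightarrow> set_pmf (W t) \<subseteq> {..<K}"
    and "total_mean T W \<le> real K"
    and "ln (real (card (drop_vectors K T))) \<le> (\<Sum>t=1..T. pmf_entropy (W t))"
proof -
  let ?S = "drop_vectors K T"
  note ne = drop_vectors_nonempty[OF K, of T] and fin = finite_drop_vectors[of K T]
  have sub: "?S \<subseteq> {1..T} \<rightarrow>\<^sub>E {..<K}"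
    by (auto simp: drop_vectors_def)
  show "set_pmf (W t) \<subseteq> {..<K}" if "t \<in> {1..T}"
    using that sub fin ne by (auto simp: W_def PiE_iff subset_iff)
  show "ln (real (card ?S)) \<le> (\<Sum>t=1..T. pmf_entropy (W t))"
    unfolding W_def by (rule ln_card_le_sum_entropy_marginals[OF _ ne sub]) simp
  have "total_mean T W = (\<Sum>t=1..T. (\<Sum>v\<in>?S. real (v t)) / real (card ?S))"
    by (simp add: total_mean_def W_def integral_pmf_of_set[OF ne fin])
  also have "\<dots> = (\<Sum>v\<in>?S. real (\<Sum>t=1..T. v t)) / real (card ?S)"
    by (simp add: sum_divide_distrib[symmetric] sum.swap[of _ ?S])
  also have "\<dots> \<le> (\<Sum>v\<in>?S. real K) / real (card ?S)"
    by (intro divide_right_mono sum_mono) (auto simp: drop_vectors_def simp del: of_nat_sum)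
  also have "\<dots> = real K"
    using fin ne by simp
  finally show "total_mean T W \<le> real K" .
qed

section \<open>Mean and entropy of the exponential distributions\<close>

lemma expectation_exponential_eq_cost:
  assumes "set_pmf p \<subseteq> {..<K}"
    and "\<And>j. j < K \<Longrightarrow> pmf p j = exp (- b * real j) / (\<Sum>s<K. exp (- b * real s))"
  shows "measure_pmf.expectation p real = cost K b"
proof -
  have "measure_pmf.expectation p real = (\<Sum>j<K. real j * pmf p j)"
    by (rule integral_measure_pmf_real) (use assms(1) in auto)
  then show ?thesis
    by (simp add: assms(2) cost_def sum_divide_distrib)
qed

text \<open>The logarithm of the mass at \<open>j\<close> is affine in \<open>j\<close>, so the
  entropy is \<open>b\<close> times the mean plus the logarithm of the normalizing sum.\<close>

lemma pmf_entropy_exponential_eq_rate: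
  assumes "K > 0" and p: "set_pmf p \<subseteq> {..<K}"
    and pmf: "\<And>j. j < K \<Longrightarrow> pmf p j = exp (- b * real j) / (\<Sum>s<K. exp (- b * real s))"
  shows "pmf_entropy p = rate K b"
proof -
  let ?Z = "\<Sum>s<K. exp (- b * real s)"
  have Z: "?Z > 0"
    using \<open>K > 0\<close> by (intro sum_pos) auto
  have "pmf_entropy p = - (\<Sum>j<K. pmf p j * (- b * real j - ln ?Z))"
    unfolding pmf_entropy_eq[OF p] using Z by (simp add: pmf ln_div)
  also have "\<dots> = b * (\<Sum>j<K. real j * pmf p j) + (\<Sum>j<K. pmf p j) * ln ?Z"
    by (simp add: sum_negf[symmetric] sum_distrib_left sum_distrib_right sum.distrib[symmetric] algebra_simps)
  also have "(\<Sum>j<K. pmf p j) = 1"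
    using p by (intro sum_pmf_eq_1) auto
  also have "(\<Sum>j<K. real j * pmf p j) = cost K b"
    by (simp add: pmf cost_def sum_divide_distrib)
  finally show ?thesis
    by (simp add: rate_def)
qed

lemma cost_pos:
  assumes "K \<ge> 2"
  shows "cost K b > 0"
proof -
  \<comment> \<open>The term \<open>j = 1\<close> is positive, and \<open>K \<ge> 2\<close> puts it
    in range.\<close>
  have "(\<Sum>j<K. real j * exp (- b * real j)) > 0"
    using assms by (intro sum_pos2[of _ 1]) auto
  moreover have "(\<Sum>s<K. exp (- b * real s)) > 0"
    using assms by (intro sum_pos) (auto simp: lessThan_empty_iff)
  ultimately show ?thesis
    by (simp add: cost_def)
qed

section \<open>Comparison with the minimizer\<close>

theorem mainTheorem2:
  fixes K T :: nat and \<alpha> p c :: real and l \<beta> :: "nat \<Rightarrow> real" and V :: "nat \<Rightarrow> nat pmf"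
  assumes "K \<ge> 2" and "T \<ge> 1" and "\<alpha> > 0"
    and "\<And>t. t \<in> {1..T} \<Longrightarrow> l t \<ge> 0"
    and "achievable K T l"
    and "p = (1 / real T) * (\<Sum>t=1..T. l t)" and "p > 0"
    and "c = (\<alpha> / real K) * (\<Sum>t=1..T. l t)"
    and "\<And>t. t \<in> {1..T} \<Longrightarrow> \<beta> t \<ge> 0"
    and "\<And>t j. t \<in> {1..T} \<Longrightarrow> j \<in> {..<K} \<Longrightarrow>
           pmf (V t) j = exp (- \<beta> t * real j) / (\<Sum>s<K. exp (- \<beta> t * real s))"
    and "is_arg_min (total_mean T) (feasible K T p) V"
  shows "c \<le> \<alpha> * (\<Sum>t=1..T. rate K (\<beta> t)) / (\<Sum>t=1..T. cost K (\<beta> t))"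
proof -
  let ?L = "\<Sum>t=1..T. l t" and ?R = "\<Sum>t=1..T. rate K (\<beta> t)" and ?D = "\<Sum>t=1..T. cost K (\<beta> t)"
  have K: "K > 0"
    using \<open>K \<ge> 2\<close> by simp
  have L: "real T * p = ?L"
    using \<open>T \<ge> 1\<close> assms(6) by simp
  have feasible_V: "feasible K T p V"
    and min_V: "feasible K T p W \<Longrightarrow> total_mean T V \<le> total_mean T W" for W
    using assms(11) by (auto simp: is_arg_min_linorder)
  have V_set: "set_pmf (V t) \<subseteq> {..<K}" if "t \<in> {1..T}" for t
    using feasible_V that by (simp add: feasible_def)
  have "?D = total_mean T V"
    unfolding total_mean_def
    using assms(10) V_set by (intro sum.cong refl expectation_exponential_eq_cost[symmetric]) auto
  \<comment> \<open>The competitor is feasible: its total entropy is at least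
    \<open>ln (card (drop_vectors K T))\<close>, which by achievability is at least
    \<open>?L = T * p\<close>.\<close>
  also have "\<dots> \<le> total_mean T (\<lambda>t. map_pmf (\<lambda>v. v t) (pmf_of_set (drop_vectors K T)))"
    using drop_vector_marginals(1)[OF K] drop_vector_marginals(3)[OF K, of T]
      achievable_sum_le[OF assms(5) K]
    by (intro min_V) (simp add: feasible_def L)
  also have "\<dots> \<le> real K"
    by (rule drop_vector_marginals(2)[OF K])
  finally have D_le: "?D \<le> real K" .
  have D_pos: "?D > 0"
    using \<open>T \<ge> 1\<close> cost_pos[OF \<open>K \<ge> 2\<close>] by (intro sum_pos) auto
  have "?R = (\<Sum>t=1..T. pmf_entropy (V t))"
    using assms(10) V_set K by (intro sum.cong refl pmf_entropy_exponential_eq_rate[symmetric]) auto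
  then have L_le: "?L \<le> ?R"
    using feasible_V by (simp add: feasible_def L)
  have "?L > 0"
    using L \<open>p > 0\<close> \<open>T \<ge> 1\<close> by (metis mult_pos_pos of_nat_0_less_iff less_le_trans zero_less_one)
  \<comment> \<open>The numerator grows from \<open>?L\<close> to \<open>?R\<close> while the
    denominator shrinks from \<open>K\<close> to \<open>?D\<close>; the \<open>K\<close> dividing in
    \<open>c\<close> is the bound on the competitor's total mean.\<close>
  then have "?L / real K \<le> ?R / ?D"
    using L_le D_le D_pos by (intro frac_le) auto
  then show ?thesis
    using mult_left_mono[of "?L / real K" "?R / ?D" \<alpha>] \<open>\<alpha> > 0\<close> assms(8) by simp
qed

end
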